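(* Let $K$ be the connected sum of a left-hand trefoil and a right-hand trefoil. Then $p(K) = 1$ and $nt(K) = 1$.
   Context: Links are oriented links in $S^3$, considered up to ambient isotopy, and are represented by oriented diagrams. Consider a disk of the projection surface in which an oriented link diagram consists of two disjoint "horizontal" arcs and two disjoint "vertical" arcs, each horizontal arc crossing each vertical arc exactly once (four crossings in total), such that the two arcs of one pair pass over the two arcs of the other pair at all four crossings. Two arcs of a pair are parallel if they run in the same direction and anti-parallel if they run in opposite directions. Each of the following moves changes the over/under information of all four crossings and leaves the diagram unchanged elsewhere: - the pass-move, allowed when both pairs are anti-parallel; - the one-two-way pass-move ($1$-$2$-move), allowed when one pair is parallel and the other pair is anti-parallel (the parallel pair may be either the over-pair or the under-pair). For a knot $K$ that can be transformed into the unknot by pass-moves and Reidemeister moves, the pass-move number $p(K)$ is the minimal number of pass-moves in a finite sequence of Reidemeister moves (and planar isotopies) and pass-moves transforming a diagram of $K$ into a diagram of the unknot. The $1$-$2$-move number $nt(K)$ is defined in the same way using $1$-$2$-moves in place of pass-moves. Only the number of pass-moves (respectively $1$-$2$-moves) is counted; Reidemeister moves are free. *)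

theory Defs
  imports Main "HOL-Library.Extended_Nat"
begin

text \<open>
  Oriented link diagrams are presented in Morse position: a generic diagram is cut by horizontal
  lines into slices, each containing a single local minimum, local maximum or crossing and otherwise
  vertical strands. A diagram is the list of its slices, read from bottom to top. A horizontal line
  is described by the list of the directions of the strands it meets, from left to right, with
  \<^term>\<open>True\<close> for upwards.

  In all slices \<open>i\<close> is the number of strands to the left of the singular point.
    \<^item> \<open>Cup i d\<close> is a local minimum whose left leg has direction \<open>d\<close> (and whose right leg has the
      opposite one).
    \<^item> \<open>Cap i\<close> is a local maximum.
    \<^item> \<open>Cross i p\<close> is a crossing. If \<open>p\<close> holds, then the strand running between bottom left
      and top right is the over-strand, otherwise the one between bottom right and top left.
\<close>

datatype slice = Cup nat bool | Cap nat | Cross nat bool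

fun step :: "slice \<Rightarrow> bool list \<Rightarrow> bool list option" where
  "step (Cup i d) s = (if i \<le> length s then Some (take i s @ [d, \<not> d] @ drop i s) else None)"
| "step (Cap i) s = (if i + 1 < length s \<and> s ! i \<noteq> s ! (i + 1)
     then Some (take i s @ drop (i + 2) s) else None)"
| "step (Cross i p) s = (if i + 1 < length s
     then Some (take i s @ [s ! (i + 1), s ! i] @ drop (i + 2) s) else None)"

primrec run :: "slice list \<Rightarrow> bool list \<Rightarrow> bool list option" where
  "run [] s = Some s"
| "run (x # w) s = Option.bind (step x s) (run w)"

definition link_diagram :: "slice list \<Rightarrow> bool" where
  "link_diagram w \<longleftrightarrow> run w [] = Some []"

text \<open>Adding \<open>k\<close> vertical strands on the left:\<close>

primrec shift :: "nat \<Rightarrow> slice \<Rightarrow> slice" where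
  "shift k (Cup i d) = Cup (k + i) d"
| "shift k (Cap i) = Cap (k + i)"
| "shift k (Cross i p) = Cross (k + i) p"

text \<open>The number of strands up to and including the singular part, below and above a slice:\<close>

primrec width_below :: "slice \<Rightarrow> nat" where
  "width_below (Cup i d) = i"
| "width_below (Cap i) = i + 2"
| "width_below (Cross i p) = i + 2"

primrec width_above :: "slice \<Rightarrow> nat" where
  "width_above (Cup i d) = i + 2"
| "width_above (Cap i) = i"
| "width_above (Cross i p) = i + 2"

text \<open>
  Planar isotopy of diagrams in Morse position is generated by the following replacements: exchanging
  the heights of two horizontally separated singular points, creating or cancelling a local minimum
  and a local maximum, and moving a crossing through a local minimum or maximum. In the last two
  rules the strand passing over (under) the extremum on one side does so on the other side as well,
  which is why \<open>p\<close> is negated.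
\<close>

inductive planar_isotopy :: "slice list \<Rightarrow> slice list \<Rightarrow> bool" where
  exchange: "planar_isotopy [x, shift (width_above x) y] [shift (width_below x) y, x]"
| zigzag_left: "planar_isotopy [Cup 1 d, Cap 0] []"
| zigzag_right: "planar_isotopy [Cup 0 d, Cap 1] []"
| cup_slide: "planar_isotopy [Cup 0 d, Cross 1 p] [Cup 1 d, Cross 0 (\<not> p)]"
| cap_slide: "planar_isotopy [Cross 1 p, Cap 0] [Cross 0 (\<not> p), Cap 1]"

text \<open>
  In \<open>R3\<close> the Booleans \<open>p\<close>, \<open>q\<close>, \<open>r\<close> say whether, of the strands \<open>1\<close>, \<open>2\<close>, \<open>3\<close> (numbered by
  their lower ends from left to right), \<open>1\<close> passes over \<open>2\<close>, \<open>1\<close> over \<open>3\<close> and \<open>2\<close> over \<open>3\<close>.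
  The side condition excludes the two cyclic configurations.
\<close>

inductive reidemeister_local :: "slice list \<Rightarrow> slice list \<Rightarrow> bool" where
  R1_right: "reidemeister_local [Cup 1 d, Cross 0 p, Cap 1] []"
| R1_left: "reidemeister_local [Cup 0 d, Cross 1 p, Cap 0] []"
| R2: "reidemeister_local [Cross 0 p, Cross 0 (\<not> p)] []"
| R3: "(p = r \<longrightarrow> q = p) \<Longrightarrow>
    reidemeister_local [Cross 0 p, Cross 1 q, Cross 0 r] [Cross 1 r, Cross 0 q, Cross 1 p]"

text \<open>
  The local rules do not mention the directions of the strands; requiring both sides to be link
  diagrams admits exactly the consistent ones.
\<close>

inductive reidemeister_step :: "slice list \<Rightarrow> slice list \<Rightarrow> bool" where
  "\<lbrakk>planar_isotopy T T' \<or> reidemeister_local T T';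
    link_diagram (A @ map (shift k) T @ B); link_diagram (A @ map (shift k) T' @ B)\<rbrakk> \<Longrightarrow>
   reidemeister_step (A @ map (shift k) T @ B) (A @ map (shift k) T' @ B)"

abbreviation reidemeister_move :: "slice list \<Rightarrow> slice list \<Rightarrow> bool" where
  "reidemeister_move \<equiv> symclp reidemeister_step"

text \<open>
  By Reidemeister's theorem, ambient isotopy classes of oriented links correspond to oriented
  diagrams up to Reidemeister moves and planar isotopy. We represent a link type by the set of its
  diagrams.
\<close>

definition link_type :: "slice list \<Rightarrow> slice list set" where
  "link_type D = {D'. link_diagram D' \<and> reidemeister_move\<^sup>*\<^sup>* D D'}"

definition unknot :: "slice list set" where
  "unknot = link_type [Cup 0 True, Cap 0]"

text \<open>
  The pattern of the pass-moves, turned by 45 degrees: the pair of arcs starting at the lower ends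
  \<open>1\<close> and \<open>2\<close> crosses the pair starting at the lower ends \<open>3\<close> and \<open>4\<close>; the former pair is the
  over-pair if and only if \<open>p\<close> holds.
\<close>

definition crossing_pairs :: "bool \<Rightarrow> slice list" where
  "crossing_pairs p = [Cross 1 p, Cross 0 p, Cross 2 p, Cross 1 p]"

inductive pass_move :: "slice list \<Rightarrow> slice list \<Rightarrow> bool" where
  "\<lbrakk>run A [] = Some (u @ [a, \<not> a, c, \<not> c] @ v);
    link_diagram (A @ map (shift (length u)) (crossing_pairs p) @ B)\<rbrakk> \<Longrightarrow>
   pass_move (A @ map (shift (length u)) (crossing_pairs p) @ B)
             (A @ map (shift (length u)) (crossing_pairs (\<not> p)) @ B)"

inductive one_two_move :: "slice list \<Rightarrow> slice list \<Rightarrow> bool" where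
  "\<lbrakk>run A [] = Some (u @ [a, b, c, d] @ v); (a = b \<and> c \<noteq> d) \<or> (a \<noteq> b \<and> c = d);
    link_diagram (A @ map (shift (length u)) (crossing_pairs p) @ B)\<rbrakk> \<Longrightarrow>
   one_two_move (A @ map (shift (length u)) (crossing_pairs p) @ B)
                (A @ map (shift (length u)) (crossing_pairs (\<not> p)) @ B)"

text \<open>
  \<open>transforms M n D D'\<close>: some finite sequence of Reidemeister moves, planar isotopies and exactly
  \<open>n\<close> moves of kind \<open>M\<close> leads from \<open>D\<close> to \<open>D'\<close>.
\<close>

inductive transforms ::
  "(slice list \<Rightarrow> slice list \<Rightarrow> bool) \<Rightarrow> nat \<Rightarrow> slice list \<Rightarrow> slice list \<Rightarrow> bool"
  for M where
  start: "link_diagram D \<Longrightarrow> transforms M 0 D D"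
| free: "transforms M n D E \<Longrightarrow> reidemeister_move E F \<Longrightarrow> transforms M n D F"
| counted: "transforms M n D E \<Longrightarrow> M E F \<Longrightarrow> transforms M (Suc n) D F"

text \<open>The infimum is a minimum, or \<open>\<infinity>\<close> if the unknot cannot be reached.\<close>

definition unknotting_number_by ::
  "(slice list \<Rightarrow> slice list \<Rightarrow> bool) \<Rightarrow> slice list set \<Rightarrow> enat" where
  "unknotting_number_by M K =
     Inf {enat n | n D D'. D \<in> K \<and> D' \<in> unknot \<and> transforms M n D D'}"

definition pass_move_number :: "slice list set \<Rightarrow> enat" where
  "pass_move_number = unknotting_number_by pass_move"

definition one_two_move_number :: "slice list set \<Rightarrow> enat" where
  "one_two_move_number = unknotting_number_by one_two_move"

text \<open>
  The closure of the two-strand braid with three equal crossings. Both braid strands point upwards,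
  so the crossings are positive if and only if \<open>p\<close> holds.
\<close>

definition trefoil :: "bool \<Rightarrow> slice list" where
  "trefoil p =
     [Cup 0 True, Cup 1 True, Cross 0 p, Cross 0 p, Cross 0 p, Cap 1, Cap 0]"

definition right_trefoil :: "slice list" where
  "right_trefoil = trefoil True"

definition left_trefoil :: "slice list" where
  "left_trefoil = trefoil False"

text \<open>
  A nonempty link diagram starts with a slice \<open>Cup 0 d\<close> and ends with the slice \<open>Cap 0\<close>. The
  connected sum places \<open>E\<close> above \<open>D\<close>, removes the final maximum of \<open>D\<close> and the initial minimum of
  \<open>E\<close>, and joins the two pairs of loose ends. It is meant for knot diagrams for which the directions
  of these ends agree; for the trefoils above, both are \<^term>\<open>[True, False]\<close>.
\<close>

definition connected_sum :: "slice list \<Rightarrow> slice list \<Rightarrow> slice list" where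
  "connected_sum D E = butlast D @ tl E"

lemma link_diagram_trefoils:
  "link_diagram left_trefoil" "link_diagram right_trefoil"
  "link_diagram (connected_sum left_trefoil right_trefoil)"
  by (simp_all add: link_diagram_def left_trefoil_def right_trefoil_def trefoil_def
      connected_sum_def)

end

theory Submission
  imports Defs
begin

text \<open>
  Let \<open>K\<close> be the connected sum of the two trefoils, the square knot.

  Neither number is \<open>0\<close>, because \<open>K\<close> is knotted: the number of Fox three-colourings of a diagram is
  unchanged by Reidemeister moves (\<open>colourings_isotopic\<close>), the circle has three of them, one for
  each colour, and the square knot has 27, because every trefoil summand can be coloured
  nontrivially and independently of the other.

  One move suffices, because \<open>K\<close> has diagrams with nine crossings that contain the pattern of the
  move in a position where the four crossings obstruct the simplification of the diagram. As they
  stand, the diagrams \<open>pass_diagram True\<close> and \<open>one_two_diagram True\<close> reduce to the standard diagram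
  of \<open>K\<close> with six crossings. Once the four crossings are switched, eight crossings cancel in pairs
  by Reidemeister moves II, in one case after a move III, and only a circle with a kink is left.

  These isotopies are explicit finite sequences of Reidemeister moves. Most of the steps of such a
  sequence in Morse position merely exchange the heights of distant slices. They are left out of the
  sequences below: two diagrams that become equal when their slices sink below the slices to their
  right are isotopic (\<open>isotopic_if_settle_eq\<close>), so that only the essential moves have to be listed
  (\<open>isotopic_if_certified\<close>).
\<close>

section \<open>Isotopy of diagrams\<close>

abbreviation isotopic :: "slice list \<Rightarrow> slice list \<Rightarrow> bool" (infix "\<approx>" 50) where
  "D \<approx> E \<equiv> reidemeister_move\<^sup>*\<^sup>* D E"

lemma isotopic_sym: "D \<approx> E \<Longrightarrow> E \<approx> D"
  by (rule rtranclp_symclp_sym)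

lemma reidemeister_move_link_diagram:
  "reidemeister_move D E \<Longrightarrow> link_diagram D \<and> link_diagram E"
  by (auto simp: symclp_pointfree elim!: reidemeister_step.cases)

lemma link_diagram_isotopic: "D \<approx> E \<Longrightarrow> link_diagram D \<Longrightarrow> link_diagram E"
  by (induction rule: rtranclp_induct) (auto dest: reidemeister_move_link_diagram)

lemma run_append: "run (A @ B) s = Option.bind (run A s) (run B)"
  by (induction A arbitrary: s) (simp_all split: bind_splits)

text \<open>
  A slice acts only on the strands up to its own width, and a shifted slice only on the strands
  from there on. This locality is what makes distant slices commute.
\<close>

lemma step_left:
  "width_below x \<le> length u \<Longrightarrow> step x (u @ v) = map_option (\<lambda>u'. u' @ v) (step x u)"
  by (cases x) (auto simp: nth_append)

lemma step_shift: "length u = k \<Longrightarrow> step (shift k y) (u @ v) = map_option ((@) u) (step y v)"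
  by (cases y) (auto simp: nth_append)

lemma length_step:
  "step x u = Some u' \<Longrightarrow> length u = width_below x \<Longrightarrow> length u' = width_above x"
  by (cases x) (auto split: if_splits)

lemma step_too_narrow: "length s < width_below x \<Longrightarrow> step x s = None"
  by (cases x) auto

lemma step_shift_too_narrow: "length s < k \<Longrightarrow> step (shift k y) s = None"
  by (cases y) auto

lemma run_exchange:
  "run [x, shift (width_above x) y] s = run [shift (width_below x) y, x] s"
proof (cases "width_below x \<le> length s")
  case True
  define u v where "u = take (width_below x) s" and "v = drop (width_below x) s"
  have s: "s = u @ v" and u: "length u = width_below x"
    using True by (simp_all add: u_def v_def)
  show ?thesis
  proof (cases "step x u")
    case None
    then show ?thesis
      by (cases "step y v") (simp_all add: s u step_left step_shift)
  next
    case (Some u')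
    then have "length u' = width_above x"
      using u by (rule length_step)
    with Some show ?thesis
      by (cases "step y v") (simp_all add: s u step_left step_shift)
  qed
next
  case False
  then show ?thesis
    by (simp add: step_too_narrow step_shift_too_narrow)
qed

section \<open>Certificates of isotopy\<close>

text \<open>A local move is given by the fragments of the diagram before and after it.\<close>

type_synonym local_move = "slice list \<times> slice list"

definition zigzag_left :: "bool \<Rightarrow> local_move" where
  "zigzag_left d = ([Cup 1 d, Cap 0], [])"

definition zigzag_right :: "bool \<Rightarrow> local_move" where
  "zigzag_right d = ([Cup 0 d, Cap 1], [])"

definition cup_slide :: "bool \<Rightarrow> bool \<Rightarrow> local_move" where
  "cup_slide d p = ([Cup 0 d, Cross 1 p], [Cup 1 d, Cross 0 (\<not> p)])"

definition cap_slide :: "bool \<Rightarrow> local_move" where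
  "cap_slide p = ([Cross 1 p, Cap 0], [Cross 0 (\<not> p), Cap 1])"

definition r1_right :: "bool \<Rightarrow> bool \<Rightarrow> local_move" where
  "r1_right d p = ([Cup 1 d, Cross 0 p, Cap 1], [])"

definition r1_left :: "bool \<Rightarrow> bool \<Rightarrow> local_move" where
  "r1_left d p = ([Cup 0 d, Cross 1 p, Cap 0], [])"

definition r2 :: "bool \<Rightarrow> local_move" where
  "r2 p = ([Cross 0 p, Cross 0 (\<not> p)], [])"

definition r3 :: "bool \<Rightarrow> bool \<Rightarrow> bool \<Rightarrow> local_move" where
  "r3 p q r = ([Cross 0 p, Cross 1 q, Cross 0 r], [Cross 1 r, Cross 0 q, Cross 1 p])"

lemmas local_move_defs = zigzag_left_def zigzag_right_def cup_slide_def cap_slide_def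
  r1_right_def r1_left_def r2_def r3_def

abbreviation undo :: "local_move \<Rightarrow> local_move" where
  "undo \<equiv> prod.swap"

lemma local_move_sides [simp]:
  "fst (zigzag_left d) = [Cup 1 d, Cap 0]" "snd (zigzag_left d) = []"
  "fst (zigzag_right d) = [Cup 0 d, Cap 1]" "snd (zigzag_right d) = []"
  "fst (cup_slide d p) = [Cup 0 d, Cross 1 p]" "snd (cup_slide d p) = [Cup 1 d, Cross 0 (\<not> p)]"
  "fst (cap_slide p) = [Cross 1 p, Cap 0]" "snd (cap_slide p) = [Cross 0 (\<not> p), Cap 1]"
  "fst (r1_right d p) = [Cup 1 d, Cross 0 p, Cap 1]" "snd (r1_right d p) = []"
  "fst (r1_left d p) = [Cup 0 d, Cross 1 p, Cap 0]" "snd (r1_left d p) = []"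
  "fst (r2 p) = [Cross 0 p, Cross 0 (\<not> p)]" "snd (r2 p) = []"
  "fst (r3 p q r) = [Cross 0 p, Cross 1 q, Cross 0 r]"
  "snd (r3 p q r) = [Cross 1 r, Cross 0 q, Cross 1 p]"
  by (simp_all add: local_move_defs)

definition allowed :: "local_move \<Rightarrow> bool" where
  "allowed = (\<lambda>(T, T'). planar_isotopy T T' \<or> planar_isotopy T' T \<or>
     reidemeister_local T T' \<or> reidemeister_local T' T)"

lemma allowed_swap [simp]: "allowed (prod.swap m) \<longleftrightarrow> allowed m"
  by (auto simp: allowed_def split: prod.splits)

lemma allowed_local_moves [simp]:
  "allowed (zigzag_left d)" "allowed (zigzag_right d)"
  "allowed (cup_slide d p)" "allowed (cap_slide p)"
  "allowed (r1_right d p)" "allowed (r1_left d p)" "allowed (r2 p)"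
  "(p = r \<longrightarrow> q = p) \<Longrightarrow> allowed (r3 p q r)"
  using planar_isotopy.intros(2-) reidemeister_local.intros
  unfolding allowed_def local_move_defs by (simp_all only: case_prod_conv, blast+)

lemma allowed_isotopic:
  assumes "allowed (T, T')" "link_diagram (A @ map (shift k) T @ B)"
    "link_diagram (A @ map (shift k) T' @ B)"
  shows "A @ map (shift k) T @ B \<approx> A @ map (shift k) T' @ B"
  using assms
  by (auto simp: allowed_def symclp_pointfree intro!: r_into_rtranclp
      intro: reidemeister_step.intros)

primrec position :: "slice \<Rightarrow> nat" where
  "position (Cup i d) = i" | "position (Cap i) = i" | "position (Cross i p) = i"

primrec unshift :: "nat \<Rightarrow> slice \<Rightarrow> slice" where
  "unshift k (Cup i d) = Cup (i - k) d"
| "unshift k (Cap i) = Cap (i - k)"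
| "unshift k (Cross i p) = Cross (i - k) p"

lemma shift_unshift: "k \<le> position x \<Longrightarrow> shift k (unshift k x) = x"
  by (cases x) auto

text \<open>
  Whenever a slice stands directly above a slice that lies entirely to its right, the two can be
  exchanged. Settling a diagram is insertion sort with respect to these exchanges. The result need
  not be a normal form: a failure to recognise two diagrams as isotopic would only make a
  certificate longer.
\<close>

fun insert_slice :: "slice \<Rightarrow> slice list \<Rightarrow> slice list" where
  "insert_slice x [] = [x]"
| "insert_slice x (y # w) =
     (if width_below y \<le> position x
      then y # insert_slice (shift (width_above y) (unshift (width_below y) x)) w
      else x # y # w)"

definition settle :: "slice list \<Rightarrow> slice list" where
  "settle w = foldr insert_slice w []"

lemma exchange_isotopic:
  assumes "link_diagram (A @ x # y # B)" "width_below y \<le> position x"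
  shows "A @ x # y # B \<approx> A @ y # shift (width_above y) (unshift (width_below y) x) # B"
proof -
  let ?z = "unshift (width_below y) x"
  have x: "x = shift (width_below y) ?z"
    using assms(2) by (simp add: shift_unshift)
  have shift_0: "shift 0 = (\<lambda>x. x)"
    by (rule ext, rename_tac x, case_tac x) auto
  have "run ([y, shift (width_above y) ?z] @ B) = run ([x, y] @ B)"
    by (rule ext) (simp only: run_append run_exchange x [symmetric])
  then have "run (A @ y # shift (width_above y) ?z # B) [] = run (A @ x # y # B) []"
    by (simp add: run_append)
  then have "link_diagram (A @ y # shift (width_above y) ?z # B)"
    using assms(1) by (simp add: link_diagram_def)
  with assms(1) x have "reidemeister_step (A @ y # shift (width_above y) ?z # B) (A @ x # y # B)"
    using reidemeister_step.intros[of "[y, shift (width_above y) ?z]" "[x, y]" A 0 B]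
      planar_isotopy.exchange[of y ?z]
    by (simp add: shift_0)
  then show ?thesis
    by (intro r_into_rtranclp) (simp add: symclp_pointfree)
qed

lemma insert_slice_isotopic:
  "link_diagram (A @ x # w) \<Longrightarrow> A @ x # w \<approx> A @ insert_slice x w"
proof (induction x w arbitrary: A rule: insert_slice.induct)
  case (2 x y w)
  show ?case
  proof (cases "width_below y \<le> position x")
    case True
    let ?x = "shift (width_above y) (unshift (width_below y) x)"
    have 1: "A @ x # y # w \<approx> (A @ [y]) @ ?x # w"
      using exchange_isotopic[OF "2.prems" True] by simp
    also have "\<dots> \<approx> (A @ [y]) @ insert_slice ?x w"
      using True 1 "2.prems" by (intro "2.IH") (auto intro: link_diagram_isotopic)
    finally show ?thesis
      using True by simp
  qed simp
qed simp

text \<open>The part \<open>A\<close> serves the induction, which splits off the lowest slice of \<open>w\<close>.\<close>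

lemma settle_isotopic: "link_diagram (A @ w) \<Longrightarrow> A @ w \<approx> A @ settle w"
proof (induction w arbitrary: A)
  case (Cons x w)
  have 1: "A @ x # w \<approx> (A @ [x]) @ settle w"
    using Cons.IH[of "A @ [x]"] Cons.prems by simp
  also have "\<dots> \<approx> A @ insert_slice x (settle w)"
    using insert_slice_isotopic[of A x] link_diagram_isotopic[OF 1 Cons.prems] by simp
  finally show ?case
    by (simp add: settle_def)
qed (simp add: settle_def)

lemma isotopic_if_settle_eq:
  assumes "link_diagram D" "link_diagram E" "settle D = settle E"
  shows "D \<approx> E"
  using settle_isotopic[of "[]" D] settle_isotopic[of "[]" E] assms isotopic_sym
  by (metis append_Nil rtranclp_trans)

text \<open>
  Each entry \<open>(A, k, m, B)\<close> of a certificate shows a whole diagram, cut open at the place of the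
  next move \<open>m\<close>: the part \<open>A\<close> below it, the number \<open>k\<close> of strands on its left, and the part \<open>B\<close>
  above it. Between two moves the diagram may be replaced by one that settles to the same diagram.
\<close>

fun certifies ::
  "slice list \<Rightarrow> (slice list \<times> nat \<times> local_move \<times> slice list) list \<Rightarrow> slice list \<Rightarrow> bool" where
  "certifies D [] E \<longleftrightarrow> settle D = settle E"
| "certifies D ((A, k, m, B) # ms) E \<longleftrightarrow>
     allowed m \<and> settle D = settle (A @ map (shift k) (fst m) @ B) \<and>
     link_diagram (A @ map (shift k) (fst m) @ B) \<and>
     link_diagram (A @ map (shift k) (snd m) @ B) \<and>
     certifies (A @ map (shift k) (snd m) @ B) ms E"

lemma isotopic_if_certified:
  "link_diagram D \<Longrightarrow> link_diagram E \<Longrightarrow> certifies D ms E \<Longrightarrow> D \<approx> E"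
proof (induction D ms E rule: certifies.induct)
  case (1 D E)
  then show ?case by (simp add: isotopic_if_settle_eq)
next
  case (2 D A k m B ms E)
  have "D \<approx> A @ map (shift k) (fst m) @ B"
    using 2 by (intro isotopic_if_settle_eq) auto
  also have "\<dots> \<approx> A @ map (shift k) (snd m) @ B"
    using 2 by (intro allowed_isotopic) auto
  also have "\<dots> \<approx> E"
    using 2 by auto
  finally show ?case .
qed

section \<open>Fox three-colourings\<close>

text \<open>
  The strands of a diagram are coloured so that at each crossing the three colours meeting there are
  all equal or all different. The operation \<open>a \<triangleright> b\<close> is the colour with which a strand of colour \<open>a\<close>
  continues after passing under a strand of colour \<open>b\<close>. Its three laws, idempotence, cancellation
  and distributivity, correspond to the three Reidemeister moves.
\<close>

datatype colour = Red | Green | Blue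

lemma UNIV_colour: "(UNIV :: colour set) = {Red, Green, Blue}"
  using colour.exhaust by auto

lemma sum_colour: "(\<Sum>c\<in>UNIV. f c) = f Red + f Green + f Blue"
  for f :: "colour \<Rightarrow> nat"
  by (simp add: UNIV_colour)

definition under :: "colour \<Rightarrow> colour \<Rightarrow> colour" (infixl "\<triangleright>" 70) where
  "a \<triangleright> b =
     (if a = b then a
      else if Red \<notin> {a, b} then Red
      else if Green \<notin> {a, b} then Green
      else Blue)"

lemma under_idem [simp]: "a \<triangleright> a = a"
  by (simp add: under_def)

lemma under_cancel [simp]: "a \<triangleright> b \<triangleright> b = a"
  by (cases a; cases b) (simp_all add: under_def)

lemma under_distrib: "(a \<triangleright> c) \<triangleright> (b \<triangleright> c) = a \<triangleright> b \<triangleright> c"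
  by (cases a; cases b; cases c) (simp_all add: under_def)

lemma under_under: "a \<triangleright> (b \<triangleright> c) \<triangleright> c = a \<triangleright> c \<triangleright> b"
  using under_distrib [of a c "b \<triangleright> c"] by simp

text \<open>
  Passing under a fixed strand permutes the colours. The two sides of a slide of a crossing through
  a minimum enumerate the colourings of the minimum in orders that may differ by this permutation.
\<close>

lemma sum_under: "(\<Sum>c\<in>UNIV. f (c \<triangleright> a)) = (\<Sum>c\<in>UNIV. f c)"
  for f :: "colour \<Rightarrow> nat"
  by (cases a) (simp_all add: sum_colour under_def)

text \<open>
  \<open>pull1 x f s\<close> is the sum of \<open>f\<close> over all colourings of the upper ends of the slice \<open>x\<close> that are
  compatible with the colouring \<open>s\<close> of its lower ends. Iterating this, a diagram is turned into a
  weighted count of its colourings. Working with functions \<open>f\<close> rather than with lists of colourings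
  makes the order of enumeration irrelevant.
\<close>

fun pull1 :: "slice \<Rightarrow> (colour list \<Rightarrow> nat) \<Rightarrow> colour list \<Rightarrow> nat" where
  "pull1 (Cup i d) f s =
     (if i \<le> length s then \<Sum>c\<in>UNIV. f (take i s @ [c, c] @ drop i s) else 0)"
| "pull1 (Cap i) f s =
     (if i + 1 < length s \<and> s ! i = s ! (i + 1) then f (take i s @ drop (i + 2) s) else 0)"
| "pull1 (Cross i p) f s =
     (if i + 1 < length s
      then f (take i s @
        (if p then [s ! (i + 1) \<triangleright> s ! i, s ! i] else [s ! (i + 1), s ! i \<triangleright> s ! (i + 1)]) @
        drop (i + 2) s)
      else 0)"

definition pull :: "slice list \<Rightarrow> (colour list \<Rightarrow> nat) \<Rightarrow> colour list \<Rightarrow> nat" where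
  "pull w f = foldr pull1 w f"

definition colourings :: "slice list \<Rightarrow> nat" where
  "colourings D = pull D (\<lambda>s. if s = [] then 1 else 0) []"

lemma pull_simps [simp]: "pull [] f = f" "pull (x # w) f = pull1 x (pull w f)"
  by (simp_all add: pull_def)

lemma pull_append: "pull (A @ B) f = pull A (pull B f)"
  by (simp add: pull_def)

lemma pull1_left:
  "width_below x \<le> length u \<Longrightarrow> pull1 x f (u @ v) = pull1 x (\<lambda>u'. f (u' @ v)) u"
  by (cases x) (auto simp: nth_append)

lemma pull1_shift:
  "length u = k \<Longrightarrow> pull1 (shift k y) f (u @ v) = pull1 y (\<lambda>v'. f (u @ v')) v"
  by (cases y) (auto simp: nth_append)

lemma pull_shift:
  "length u = k \<Longrightarrow> pull (map (shift k) w) f (u @ v) = pull w (\<lambda>v'. f (u @ v')) v"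
  by (induction w arbitrary: f v) (auto simp: pull1_shift)

lemma pull1_too_narrow: "length s < width_below x \<Longrightarrow> pull1 x f s = 0"
  by (cases x) auto

lemma pull1_shift_too_narrow: "length s < k \<Longrightarrow> pull1 (shift k y) f s = 0"
  by (cases y) auto

lemma pull1_commute:
  "pull1 x (\<lambda>u'. pull1 y (\<lambda>v'. f (u' @ v')) v) u =
   pull1 y (\<lambda>v'. pull1 x (\<lambda>u'. f (u' @ v')) u) v"
  by (cases x; cases y) (auto intro: sum.swap)

lemma pull1_cong:
  assumes "\<And>s'. length s' + width_below x = length s + width_above x \<Longrightarrow> f s' = g s'"
  shows "pull1 x f s = pull1 x g s"
  using assms by (cases x) auto

lemma pull_exchange:
  "pull [x, shift (width_above x) y] f s = pull [shift (width_below x) y, x] f s"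
proof (cases "width_below x \<le> length s")
  case True
  define u v where "u = take (width_below x) s" and "v = drop (width_below x) s"
  have s: "s = u @ v" and u: "length u = width_below x"
    using True by (simp_all add: u_def v_def)
  have "pull [x, shift (width_above x) y] f s =
      pull1 x (\<lambda>u'. pull1 (shift (width_above x) y) f (u' @ v)) u"
    by (simp add: s u pull1_left)
  also have "\<dots> = pull1 x (\<lambda>u'. pull1 y (\<lambda>v'. f (u' @ v')) v) u"
    by (rule pull1_cong) (simp add: u pull1_shift)
  also have "\<dots> = pull1 y (\<lambda>v'. pull1 x (\<lambda>u'. f (u' @ v')) u) v"
    by (rule pull1_commute)
  also have "\<dots> = pull [shift (width_below x) y, x] f s"
    by (simp add: s u pull1_left pull1_shift)
  finally show ?thesis .
next
  case False
  have "pull1 x g s = 0" for g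
    using False by (intro pull1_too_narrow) simp
  moreover have "pull1 (shift (width_below x) y) g s = 0" for g
    using False by (intro pull1_shift_too_narrow) simp
  ultimately show ?thesis
    by simp
qed

text \<open>
  Invariance has to hold for each colouring \<open>v\<close> of the lower ends of the fragments separately,
  because the rest of the diagram may continue them in different ways. As \<open>T\<close> fits on top of a
  list of directions of the same length, \<open>v\<close> has enough entries: on fewer strands \<open>T\<close> would count
  nothing, while an empty \<open>T'\<close> would still return \<open>f v\<close>.
\<close>

lemma pull_local_move:
  assumes "planar_isotopy T T' \<or> reidemeister_local T T'"
    and "run T s \<noteq> None" "length v = length s"
  shows "pull T f v = pull T' f v"
proof -
  have wide1: "\<exists>a v'. v = a # v'" if "1 \<le> length v"
    using that by (auto simp: Suc_le_length_iff numeral_eq_Suc)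
  have wide2: "\<exists>a b v'. v = a # b # v'" if "2 \<le> length v"
    using that by (auto simp: Suc_le_length_iff numeral_eq_Suc)
  have wide3: "\<exists>a b c v'. v = a # b # c # v'" if "3 \<le> length v"
    using that by (auto simp: Suc_le_length_iff numeral_eq_Suc)
  show ?thesis
    using assms(1)
  proof (elim disjE)
    assume "planar_isotopy T T'"
    then show ?thesis
    proof cases
      case (exchange x y)
      then show ?thesis by (simp only: pull_exchange)
    next
      case (zigzag_left d)
      then obtain a v' where "v = a # v'"
        using assms(2,3) wide1 by (auto simp: Suc_le_eq split: if_splits)
      then show ?thesis
        by (cases a) (simp_all add: zigzag_left sum_colour)
    next
      case (zigzag_right d)
      then obtain a v' where "v = a # v'"
        using assms(2,3) wide1 by (auto simp: Suc_le_eq split: if_splits)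
      then show ?thesis
        by (cases a) (simp_all add: zigzag_right sum_colour)
    next
      case (cup_slide d p)
      then obtain a v' where v: "v = a # v'"
        using assms(2,3) wide1 by (auto simp: Suc_le_eq split: if_splits)
      show ?thesis
        using sum_under[of "\<lambda>c. f (c \<triangleright> a # a # c # v')" a]
        by (cases p) (simp_all add: cup_slide v)
    next
      case (cap_slide p)
      then obtain a b c v' where v: "v = a # b # c # v'"
        using assms wide3 by (auto simp: Suc_le_eq split: if_splits)
      show ?thesis
        by (cases a; cases b; cases c) (simp_all add: cap_slide v under_def)
    qed
  next
    assume "reidemeister_local T T'"
    then show ?thesis
    proof cases
      case (R1_right d p)
      then obtain a v' where "v = a # v'"
        using assms(2,3) wide1 by (auto simp: Suc_le_eq split: if_splits)
      then show ?thesis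
        by (cases a) (simp_all add: R1_right sum_colour under_def)
    next
      case (R1_left d p)
      then obtain a v' where "v = a # v'"
        using assms(2,3) wide1 by (auto simp: Suc_le_eq split: if_splits)
      then show ?thesis
        by (cases a) (simp_all add: R1_left sum_colour under_def)
    next
      case (R2 p)
      then obtain a b v' where "v = a # b # v'"
        using assms wide2 by (auto simp: Suc_le_eq split: if_splits)
      then show ?thesis
        by (simp add: R2)
    next
      case (R3 p r q)
      then obtain a b c v' where v: "v = a # b # c # v'"
        using assms wide3 by (auto simp: Suc_le_eq split: if_splits)
      \<comment> \<open>A cyclic configuration has no top strand and would not preserve the count.\<close>
      have "p = q \<or> q = r"
        using R3(3) by auto
      then show ?thesis
        by (cases p; cases q; cases r; simp add: R3(1,2) v under_distrib under_under)
    qed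
  qed
qed

text \<open>
  Only colourings with one colour for each strand above \<open>A\<close> contribute. Hence the invariance of a
  fragment, which is limited to colourings with enough entries, can be used above any \<open>A\<close>.
\<close>

lemma pull_cong:
  assumes "run A s = Some t" "length s' = length s"
    and "\<And>t'. length t' = length t \<Longrightarrow> f t' = g t'"
  shows "pull A f s' = pull A g s'"
  using assms(1,2)
proof (induction A arbitrary: s s')
  case Nil
  then show ?case using assms(3) by simp
next
  case (Cons x A)
  then obtain r where r: "step x s = Some r" "run A r = Some t"
    by (auto split: bind_splits)
  have "pull1 x (pull A f) s' = pull1 x (pull A g) s'"
  proof (rule pull1_cong)
    fix s'' :: "colour list"
    assume "length s'' + width_below x = length s' + width_above x"
    then have "length s'' = length r"
      using r(1) Cons.prems(2) by (cases x) (auto split: if_splits)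
    then show "pull A f s'' = pull A g s''"
      using Cons.IH r(2) by blast
  qed
  then show ?case by simp
qed

lemma length_shift_domain:
  "run (map (shift k) T) t \<noteq> None \<Longrightarrow> T \<noteq> [] \<Longrightarrow> k \<le> length t"
  by (cases T) (auto simp: step_shift_too_narrow not_less[symmetric] split: bind_splits)

lemma run_shift:
  "length u = k \<Longrightarrow> run (map (shift k) T) (u @ v) = map_option ((@) u) (run T v)"
  by (induction T arbitrary: v) (auto simp: step_shift split: bind_splits)

lemma colourings_reidemeister_step:
  assumes "reidemeister_step D E"
  shows "colourings D = colourings E"
  using assms
proof cases
  case (1 T T' A k B)
  obtain t where t: "run A [] = Some t" and T: "run (map (shift k) T) t \<noteq> None"
    using 1(4) by (auto simp: link_diagram_def run_append split: bind_splits)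
  have "T \<noteq> []"
    using 1(3) by (auto elim: planar_isotopy.cases reidemeister_local.cases)
  then have k: "k \<le> length t"
    using T by (rule length_shift_domain[rotated])
  have T: "run T (drop k t) \<noteq> None"
    using T k run_shift[of "take k t" k T "drop k t"] by auto
  have "pull A (pull (map (shift k) T @ B) f) [] = pull A (pull (map (shift k) T' @ B) f) []" for f
  proof (rule pull_cong[OF t])
    fix t' :: "colour list"
    assume t': "length t' = length t"
    then show "pull (map (shift k) T @ B) f t' = pull (map (shift k) T' @ B) f t'"
      using pull_local_move[OF 1(3) T, of "drop k t'"] k
        pull_shift[of "take k t'" k _ "pull B f" "drop k t'"]
      by (simp add: pull_append)
  qed simp
  then show ?thesis
    by (simp add: 1(1,2) colourings_def pull_append)
qed

lemma colourings_isotopic: "D \<approx> E \<Longrightarrow> colourings D = colourings E"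
  by (induction rule: rtranclp_induct) (auto elim!: symclpE dest: colourings_reidemeister_step)

lemma colourings_unknot: "colourings [Cup 0 d, Cap 0] = 3"
  by (simp add: colourings_def UNIV_colour)

section \<open>Unknotting by a single move\<close>

lemma transforms_zeroD: "transforms M n D E \<Longrightarrow> n = 0 \<Longrightarrow> D \<approx> E"
  by (induction rule: transforms.induct) (auto intro: rtranclp.rtrancl_into_rtrancl)

text \<open>
  Without a counted move only isotopic diagrams are reached, so a colouring number other than three
  excludes \<open>0\<close>. A single move \<open>M\<close> is enough, because the sequence may start at any diagram \<open>E\<close> of
  the knot and stop at any diagram \<open>F\<close> of the unknot.
\<close>

lemma unknotting_number_by_eq_1:
  assumes "link_diagram D" "colourings D \<noteq> 3"
    and "E \<approx> D" "M E F" "F \<approx> [Cup 0 True, Cap 0]"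
  shows "unknotting_number_by M (link_type D) = 1"
proof (rule antisym)
  have "link_diagram [Cup 0 True, Cap 0]"
    by (simp add: link_diagram_def)
  then have E: "link_diagram E" "E \<in> link_type D" and F: "F \<in> unknot"
    using assms by (auto simp: link_type_def unknot_def dest: isotopic_sym link_diagram_isotopic)
  have "transforms M (Suc 0) E F"
    using E(1) assms(4) by (blast intro: transforms.intros)
  with E F show "unknotting_number_by M (link_type D) \<le> 1"
    unfolding unknotting_number_by_def one_enat_def by (intro Inf_lower) auto
next
  have "n \<noteq> 0" if "D' \<in> link_type D" "U \<in> unknot" "transforms M n D' U" for n D' U
  proof
    assume "n = 0"
    then have "colourings D = colourings U"
      using that transforms_zeroD colourings_isotopic
      by (metis (no_types, lifting) link_type_def mem_Collect_eq)
    also have "\<dots> = colourings [Cup 0 True, Cap 0]"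
      using that(2) by (auto simp: unknot_def link_type_def dest: colourings_isotopic)
    also have "\<dots> = 3"
      by (rule colourings_unknot)
    finally show False
      using assms(2) by simp
  qed
  then show "1 \<le> unknotting_number_by M (link_type D)"
    unfolding unknotting_number_by_def by (intro Inf_greatest) (auto simp: one_enat_def Suc_le_eq)
qed

section \<open>Diagrams of the square knot\<close>

definition square_knot :: "slice list" where
  "square_knot = connected_sum left_trefoil right_trefoil"

lemma colourings_square_knot: "colourings square_knot = 27"
  by (simp add: square_knot_def colourings_def connected_sum_def left_trefoil_def
      right_trefoil_def trefoil_def sum_colour under_def)

text \<open>
  Both diagrams arise from the standard diagram by the isotopies below, read backwards, which add
  three crossings in order to create the pattern. At the pattern of \<open>pass_diagram\<close> the directions
  of the strands are \<^term>\<open>[True, False, False, True, True, False]\<close>, and the pattern involves the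
  first four strands; at the pattern of \<open>one_two_diagram\<close> they are
  \<^term>\<open>[False, True, False, True, True, False]\<close>, and it involves the middle four.
\<close>

definition pass_diagram :: "bool \<Rightarrow> slice list" where
  "pass_diagram p =
     [Cup 0 False, Cup 1 True, Cross 0 True, Cup 4 True, Cross 3 False, Cross 3 False] @
     map (shift 0) (crossing_pairs p) @
     [Cap 3, Cross 1 True, Cross 2 False, Cap 1, Cap 0]"

definition one_two_diagram :: "bool \<Rightarrow> slice list" where
  "one_two_diagram p =
     [Cup 0 True, Cup 1 False, Cross 0 True, Cup 0 False] @
     map (shift 1) (crossing_pairs p) @
     [Cross 1 False, Cross 2 False, Cap 3, Cross 1 True, Cross 0 False, Cap 1, Cap 0]"

lemmas diagram_defs = pass_diagram_def one_two_diagram_def crossing_pairs_def square_knot_def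
  connected_sum_def left_trefoil_def right_trefoil_def trefoil_def

text \<open>
  A Reidemeister move II leaves seven crossings. Then a kink is created, two moves III follow, and a
  kink is removed: this straightens the left-hand summand, whose three equal crossings now form a
  two-strand braid. The same trick, a kink followed by two moves III, is applied to the right-hand
  summand, where the two superfluous crossings disappear by a move II.
\<close>

lemma pass_diagram_square_knot: "pass_diagram True \<approx> square_knot"
  by (rule isotopic_if_certified [where ms = "[
      ([Cup 0 False],
       0, undo (cup_slide True False),
       [Cross 1 True, Cross 0 True, Cup 4 True, Cross 3 False, Cross 3 False, Cross 2 True,
        Cross 1 True, Cross 1 True, Cap 3, Cross 2 False, Cap 1, Cap 0]),
      ([Cup 0 True, Cup 2 False],
       1, r2 False,
       [Cross 0 True, Cup 4 True, Cross 3 False, Cross 3 False, Cross 2 True, Cross 1 True,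
        Cross 1 True, Cap 3, Cross 2 False, Cap 1, Cap 0]),
      ([Cup 0 True, Cross 0 True, Cup 2 False, Cup 4 True, Cross 3 False],
       4, undo (r1_right True False),
       [Cross 3 False, Cross 2 True, Cross 1 True, Cross 1 True, Cap 3, Cross 2 False, Cap 1,
        Cap 0]),
      ([Cup 0 True, Cross 0 True, Cup 2 False, Cup 4 True, Cup 5 True],
       3, r3 False False False,
       [Cross 2 True, Cross 1 True, Cross 1 True, Cap 3, Cap 3, Cross 2 False, Cap 1, Cap 0]),
      ([Cup 0 True, Cross 0 True, Cup 2 False, Cup 4 True, Cup 5 True, Cross 4 False,
        Cross 3 False, Cross 4 False],
       2, undo (cap_slide False),
       [Cross 1 True, Cross 1 True, Cap 3, Cross 2 False, Cap 1, Cap 0]),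
      ([Cup 0 True, Cross 0 True, Cup 2 False, Cup 4 True, Cup 5 True, Cross 4 False],
       3, r3 False False False,
       [Cap 2, Cross 1 True, Cross 1 True, Cap 3, Cross 2 False, Cap 1, Cap 0]),
      ([Cup 0 True, Cross 0 True, Cup 2 True, Cup 3 True, Cross 2 False, Cross 2 False],
       2, r1_left False False,
       [Cross 2 False, Cross 1 True, Cross 1 True, Cap 3, Cross 2 False, Cap 1, Cap 0]),
      ([Cup 0 True, Cross 0 True, Cup 2 True, Cup 3 True, Cross 2 False, Cross 2 False,
        Cross 2 False, Cross 1 True],
       2, undo (r1_right True True),
       [Cross 1 True, Cap 3, Cross 2 False, Cap 1, Cap 0]),
      ([Cup 0 True, Cross 0 True, Cup 2 True, Cup 3 True, Cross 2 False, Cross 2 False,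
        Cross 2 False, Cup 3 True],
       1, r3 True True True,
       [Cap 3, Cap 3, Cross 2 False, Cap 1, Cap 0]),
      ([Cup 0 True, Cross 0 True, Cup 2 True, Cup 3 True, Cross 2 False, Cross 2 False,
        Cross 2 False, Cup 3 True, Cross 2 True, Cross 1 True, Cross 2 True, Cap 3, Cap 3],
       1, cap_slide False,
       [Cap 0]),
      ([Cup 0 True, Cross 0 True, Cup 2 True, Cup 3 True, Cross 2 False, Cross 2 False,
        Cross 2 False, Cup 3 True, Cross 2 True, Cross 1 True, Cross 2 True],
       0, cap_slide True,
       [Cap 1, Cap 1, Cap 0]),
      ([Cup 0 True, Cup 2 True, Cup 3 True, Cross 2 False, Cross 2 False, Cross 2 False,
        Cup 3 True, Cross 2 True],
       0, r3 True True False,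
       [Cross 2 True, Cap 1, Cap 1, Cap 1, Cap 0]),
      ([Cup 0 True, Cup 2 True, Cup 3 True, Cross 2 False, Cross 2 False, Cross 2 False,
        Cup 3 True, Cross 2 True, Cross 1 False, Cross 0 True, Cross 1 True],
       1, cap_slide True,
       [Cap 1, Cap 1, Cap 0]),
      ([Cup 0 True, Cup 2 True, Cup 3 True, Cross 2 False, Cross 2 False, Cross 2 False,
        Cup 3 True, Cross 2 True, Cross 1 False, Cross 0 True],
       1, r2 True,
       [Cap 2, Cap 1, Cap 1, Cap 0]),
      ([Cup 0 True, Cup 1 True, Cross 0 False, Cross 0 False, Cross 0 False, Cup 1 True,
        Cross 0 True],
       0, cup_slide True False,
       [Cross 0 True, Cap 2, Cap 1, Cap 1, Cap 0]),
      ([Cup 0 True, Cup 1 True, Cross 0 False, Cross 0 False, Cross 0 False, Cup 1 True,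
        Cross 0 True],
       1, zigzag_right True,
       [Cross 0 True, Cross 0 True, Cap 1, Cap 1, Cap 0])]"])
     (simp_all add: diagram_defs link_diagram_def settle_def)

text \<open>
  After the switch the crossings cancel in pairs by four moves II, until one kink is left. The kink
  could be removed on either of its two sides; removing its right lobe leaves a circle with the
  direction of the standard one, removing the left lobe would leave the opposite direction.
\<close>

lemma pass_diagram_unknot: "pass_diagram False \<approx> [Cup 0 True, Cap 0]"
  by (rule isotopic_if_certified [where ms = "[
      ([Cup 0 False, Cup 1 True, Cross 0 True, Cross 1 False, Cross 0 False, Cup 4 True,
        Cross 3 False, Cross 3 False, Cross 2 False],
       1, r2 False,
       [Cap 3, Cross 2 False, Cap 1, Cap 0]),
      ([Cup 0 False, Cup 1 True, Cross 0 True, Cross 1 False, Cross 0 False, Cup 4 True,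
        Cross 3 False, Cross 3 False],
       2, undo (cap_slide True),
       [Cross 2 False, Cap 1, Cap 0]),
      ([Cup 0 False, Cup 1 True, Cross 0 True, Cross 1 False, Cross 0 False, Cup 4 True,
        Cross 3 False],
       3, r2 False,
       [Cap 2, Cross 2 False, Cap 1, Cap 0]),
      ([Cup 0 False, Cup 1 True, Cross 0 True, Cross 1 False, Cross 0 False],
       3, undo (cup_slide True True),
       [Cap 2, Cross 2 False, Cap 1, Cap 0]),
      ([Cup 0 False, Cup 1 True, Cross 0 True, Cross 1 False, Cross 0 False, Cup 3 True, Cap 2],
       2, r2 True,
       [Cap 1, Cap 0]),
      ([Cup 0 False, Cup 1 True, Cross 0 True, Cross 1 False, Cross 0 False],
       2, zigzag_left True,
       [Cap 1, Cap 0]),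
      ([Cup 0 False, Cup 1 True, Cross 0 True, Cross 1 False],
       0, undo (cap_slide True),
       [Cap 0]),
      ([Cup 0 False, Cup 1 True, Cross 0 True],
       1, r2 False,
       [Cap 0, Cap 0]),
      ([Cup 0 False],
       0, undo (cup_slide True False),
       [Cap 0, Cap 0]),
      ([Cup 0 True],
       1, r1_right False False,
       [Cap 0])]"])
     (simp_all add: diagram_defs link_diagram_def settle_def)

text \<open>
  Moves III and II leave seven crossings. A kink is created, two moves III follow, and a kink is
  removed, which produces the three equal crossings of the right-hand summand. In the left-hand
  summand one more move III turns the seventh crossing into a kink; the zigzag that follows only
  brings this kink into the position of a move I.
\<close>

lemma one_two_diagram_square_knot: "one_two_diagram True \<approx> square_knot"
  by (rule isotopic_if_certified [where ms = "[
      ([Cup 0 False, Cup 2 True, Cup 3 False, Cross 2 True, Cross 2 True, Cross 1 True,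
        Cross 3 True],
       1, undo (r3 False False True),
       [Cross 1 True, Cross 0 False, Cap 1, Cap 1, Cap 0]),
      ([Cup 0 False, Cup 2 True, Cup 3 False, Cross 2 True, Cross 2 True],
       1, r2 True,
       [Cross 3 True, Cross 2 False, Cross 1 True, Cross 1 True, Cross 0 False, Cap 1, Cap 1,
        Cap 0]),
      ([Cup 0 False, Cup 2 True, Cup 3 False, Cross 2 True, Cross 2 True, Cross 3 True,
        Cross 2 False, Cross 1 True],
       2, undo (r1_right True True),
       [Cross 1 True, Cross 0 False, Cap 1, Cap 1, Cap 0]),
      ([Cup 0 False, Cup 2 True, Cup 3 False, Cross 2 True, Cross 2 True, Cross 3 True,
        Cross 2 False, Cup 3 True],
       1, r3 True True True,
       [Cross 0 False, Cap 1, Cap 1, Cap 1, Cap 0]),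
      ([Cup 0 False, Cup 2 True, Cup 3 False, Cross 2 True, Cross 2 True, Cross 3 True,
        Cross 2 False, Cup 3 True, Cross 2 True, Cross 1 True, Cross 2 True],
       0, undo (cap_slide True),
       [Cap 1, Cap 1, Cap 0]),
      ([Cup 0 False, Cup 2 True, Cup 3 False, Cross 2 True, Cross 2 True, Cross 3 True,
        Cross 2 False, Cup 3 True, Cross 2 True],
       1, r3 True True True,
       [Cap 0, Cap 1, Cap 1, Cap 0]),
      ([Cup 0 True, Cup 1 False, Cross 0 True, Cross 0 True, Cross 1 True, Cross 0 False,
        Cup 1 True, Cross 0 True, Cross 0 True],
       0, r1_left False True,
       [Cross 0 True, Cap 1, Cap 1, Cap 0]),
      ([Cup 0 True],
       0, undo (cup_slide False False),
       [Cross 0 True, Cross 1 True, Cross 0 False, Cup 1 True, Cross 0 True, Cross 0 True,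
        Cross 0 True, Cap 1, Cap 1, Cap 0]),
      ([Cup 0 False, Cup 2 True],
       0, undo (r3 True True False),
       [Cross 0 False, Cup 1 True, Cross 0 True, Cross 0 True, Cross 0 True, Cap 1, Cap 1, Cap 0]),
      ([Cup 0 False, Cross 0 True],
       0, undo (zigzag_right True),
       [Cup 2 True, Cross 1 True, Cross 0 False, Cross 0 False, Cup 1 True, Cross 0 True,
        Cross 0 True, Cross 0 True, Cap 1, Cap 1, Cap 0]),
      ([Cup 0 True, Cup 2 False],
       1, cap_slide True,
       [Cup 2 True, Cross 1 True, Cross 0 False, Cross 0 False, Cup 1 True, Cross 0 True,
        Cross 0 True, Cross 0 True, Cap 1, Cap 1, Cap 0]),
      ([Cup 0 True],
       1, r1_right False False,
       [Cup 2 True, Cross 1 True, Cross 0 False, Cross 0 False, Cup 1 True, Cross 0 True,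
        Cross 0 True, Cross 0 True, Cap 1, Cap 1, Cap 0]),
      ([Cup 0 True],
       0, cup_slide True True,
       [Cross 0 False, Cross 0 False, Cup 1 True, Cross 0 True, Cross 0 True, Cross 0 True,
        Cap 1, Cap 1, Cap 0])]"])
     (simp_all add: diagram_defs link_diagram_def settle_def)

text \<open>
  After the switch one move III makes two crossings of opposite type adjacent; they and three
  further pairs cancel by moves II, and a circle with one kink remains.
\<close>

lemma one_two_diagram_unknot: "one_two_diagram False \<approx> [Cup 0 True, Cap 0]"
  by (rule isotopic_if_certified [where ms = "[
      ([Cup 0 False, Cup 2 True, Cup 3 False, Cross 2 True, Cross 2 False, Cross 1 False,
        Cross 3 False, Cross 2 False],
       1, r3 False False True,
       [Cross 0 False, Cap 1, Cap 1, Cap 0]),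
      ([Cup 0 False, Cup 2 True, Cup 3 False, Cross 2 True, Cross 2 False, Cross 1 False,
        Cross 3 False],
       2, r2 False,
       [Cross 1 False, Cross 0 False, Cross 2 False, Cap 1, Cap 1, Cap 0]),
      ([Cup 0 False, Cup 2 True, Cup 3 False, Cross 2 True, Cross 2 False, Cross 1 False,
        Cross 1 False, Cross 0 False, Cross 3 False],
       2, undo (cap_slide True),
       [Cap 1, Cap 0]),
      ([Cup 0 False, Cup 2 True, Cup 3 False, Cross 2 True, Cross 2 False, Cross 1 False,
        Cross 1 False, Cross 0 False],
       3, r2 False,
       [Cap 2, Cap 1, Cap 0]),
      ([Cup 0 False, Cup 2 True, Cup 3 False],
       2, r2 True,
       [Cross 1 False, Cross 1 False, Cross 0 False, Cap 2, Cap 1, Cap 0]),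
      ([Cup 0 False, Cup 2 True, Cross 1 False, Cross 1 False, Cross 0 False],
       2, zigzag_left False,
       [Cap 1, Cap 0]),
      ([Cup 0 False, Cup 2 True, Cross 1 False, Cross 1 False],
       0, undo (cap_slide True),
       [Cap 0]),
      ([Cup 0 False, Cup 2 True, Cross 1 False],
       1, r2 False,
       [Cap 0, Cap 0]),
      ([Cup 0 True],
       0, r1_left False False,
       [Cap 0])]"])
     (simp_all add: diagram_defs link_diagram_def settle_def)

lemma pass_move_pass_diagram: "pass_move (pass_diagram True) (pass_diagram False)"
  using pass_move.intros [where u = "[]" and a = True and c = False and v = "[True, False]"
      and p = True
      and A = "[Cup 0 False, Cup 1 True, Cross 0 True, Cup 4 True, Cross 3 False, Cross 3 False]"
      and B = "[Cap 3, Cross 1 True, Cross 2 False, Cap 1, Cap 0]"]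
  by (simp add: pass_diagram_def crossing_pairs_def link_diagram_def)

lemma one_two_move_one_two_diagram: "one_two_move (one_two_diagram True) (one_two_diagram False)"
  using one_two_move.intros [where u = "[False]" and a = True and b = False and c = True
      and d = True and v = "[False]" and p = True
      and A = "[Cup 0 True, Cup 1 False, Cross 0 True, Cup 0 False]"
      and B = "[Cross 1 False, Cross 2 False, Cap 3, Cross 1 True, Cross 0 False, Cap 1, Cap 0]"]
  by (simp add: one_two_diagram_def crossing_pairs_def link_diagram_def)

theorem theorem4p1:
  fixes K :: "slice list set"
  assumes "K = link_type (connected_sum left_trefoil right_trefoil)"
  shows "pass_move_number K = 1 \<and> one_two_move_number K = 1"
proof -
  have "link_diagram square_knot" "colourings square_knot \<noteq> 3"
    using link_diagram_trefoils(3) colourings_square_knot by (simp_all add: square_knot_def)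
  then show ?thesis
    unfolding assms pass_move_number_def one_two_move_number_def square_knot_def [symmetric]
    using unknotting_number_by_eq_1 pass_diagram_square_knot pass_move_pass_diagram
      pass_diagram_unknot one_two_diagram_square_knot one_two_move_one_two_diagram
      one_two_diagram_unknot
    by blast
qed

end
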